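(* Let $\nabla_m(z)=\sum_{k=0}^{\lfloor m/2\rfloor}c_{m-2k}z^{m-2k}$ be the Conway polynomial, of degree $m$, of a two-bridge link (or knot). Then for every integer $k$ with $0\le k\le\lfloor m/2\rfloor$, $$|c_{m-2k}|\le\binom{m-k}{k}|c_m|.$$ If equality holds for some positive integer $k<\lfloor m/2\rfloor$, then it holds for all integers $k$ with $0\le k\le \lfloor m/2\rfloor$. In this case the link is isotopic, up to mirror symmetry, to the link of Conway form $C(2,-2,2,\dots,(-1)^{m+1}2)$ or to the link of Conway form $C(2,2,\dots,2)$ (both with $m$ entries).
   Context: Extended Euler continuant polynomials: for integers $b_1,\dots,b_m$, $D_m(b_1,\dots,b_m)(z)$ is defined by $D_{-1}=0$, $D_0=1$, $D_k=b_k z D_{k-1}+D_{k-2}$. Two-bridge links: for nonzero integers $b_1,\dots,b_m$ ($m\ge 0$), $C(2b_1,-2b_2,\dots,(-1)^{m-1}2b_m)$ denotes the two-bridge link in Conway normal form with these numbers of signed crossings in its successive twist regions (its Schubert fraction is the continued fraction $[2b_1,-2b_2,\dots,(-1)^{m-1}2b_m]$, where $[a_1,\dots,a_n]=a_1+1/(a_2+1/(\cdots+1/a_n))$), oriented so that the two strands of each twist region are antiparallel (it bounds the linear plumbing of $m$ unknotted annuli with $|b_1|,\dots,|b_m|$ full twists). Every oriented two-bridge link is of this form. The mirror image is obtained by changing the sign of all $b_i$. The Conway polynomial of an oriented link is defined by $\nabla_{\text{unknot}}=1$ and $\nabla_{L_+}-\nabla_{L_-}=z\nabla_{L_0}$.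 It is known (Siebenmann; Cromwell) that the Conway polynomial of $C(2b_1,-2b_2,\dots,(-1)^{m-1}2b_m)$ is $D_m(b_1,\dots,b_m)(z)$; in particular it has degree $m$ and leading coefficient $c_m=b_1\cdots b_m$. *)

theory Defs
  imports "HOL-Computational_Algebra.Polynomial"
begin

section \<open>Oriented link diagrams\<close>

text \<open>
  An oriented link diagram in the plane, in general position with respect to the height
  function, is cut by horizontal lines into elementary slices, listed from bottom to top.
  The slice \<open>(i, g)\<close> consists of the elementary piece \<open>g\<close> with exactly \<open>i\<close> vertical strands
  to its left. A minimum \<open>Cup\<close> carries the orientation of its left leg (\<open>True\<close> means upward);
  these labels orient the whole diagram. In \<open>Cross c\<close> two strands cross; the strand running
  from bottom left to top right is the upper one iff \<open>c\<close>.
\<close>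

datatype piece = Cup bool | Cap | Cross bool

type_synonym slice = "nat \<times> piece"
type_synonym diagram = "slice list"

fun ins :: "piece \<Rightarrow> nat" where
  "ins (Cup a) = 0"
| "ins Cap = 2"
| "ins (Cross c) = 2"

fun outs :: "piece \<Rightarrow> nat" where
  "outs (Cup a) = 2"
| "outs Cap = 0"
| "outs (Cross c) = 2"

text \<open>
  A level of a diagram is described by the orientations of its strands from left to right.
  The result \<open>None\<close> means that the slice does not fit on top of the given level.
\<close>

fun slice_step :: "slice \<Rightarrow> bool list \<Rightarrow> bool list option" where
  "slice_step (i, Cup a) s =
     (if i \<le> length s then Some (take i s @ [a, \<not> a] @ drop i s) else None)"
| "slice_step (i, Cap) s =
     (if i + 1 < length s \<and> s ! i \<noteq> s ! (i + 1) then Some (take i s @ drop (i + 2) s) else None)"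
| "slice_step (i, Cross c) s =
     (if i + 1 < length s then Some (take i s @ [s ! (i + 1), s ! i] @ drop (i + 2) s) else None)"

fun run :: "diagram \<Rightarrow> bool list \<Rightarrow> bool list option" where
  "run [] s = Some s"
| "run (x # d) s = Option.bind (slice_step x s) (run d)"

definition link_diagram :: "diagram \<Rightarrow> bool" where
  "link_diagram d \<longleftrightarrow> run d [] = Some []"


section \<open>Isotopy\<close>

text \<open>
  Reidemeister's theorem for diagrams with a height function (Freyd--Yetter, Turaev): two
  diagrams represent isotopic oriented links iff they are related by a sequence of the
  following local moves and their inverses. The first seven rules generate planar isotopy;
  R1, R2, R3 are the Reidemeister moves, of which the missing variants are consequences.
  In R1 the crossing exchanges the legs of the minimum, hence the change of its label.
\<close>

inductive local_move :: "diagram \<Rightarrow> diagram \<Rightarrow> bool" where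
  exchange: "local_move [(i, e), (i + outs e + k, f)] [(i + ins e + k, f), (i, e)]"
| zigzag_right: "local_move [(i, Cup a), (i + 1, Cap)] []"
| zigzag_left: "local_move [(i + 1, Cup a), (i, Cap)] []"
| slide_cup: "local_move [(i, Cup a), (i + 1, Cross c)] [(i + 1, Cup a), (i, Cross (\<not> c))]"
| slide_cap: "local_move [(i + 1, Cross c), (i, Cap)] [(i, Cross (\<not> c)), (i + 1, Cap)]"
| R1_cup: "local_move [(i, Cup a), (i, Cross c)] [(i, Cup (\<not> a))]"
| R1_cap: "local_move [(i, Cross c), (i, Cap)] [(i, Cap)]"
| R2: "local_move [(i, Cross c), (i, Cross (\<not> c))] []"
| R3: "local_move [(i, Cross c), (i + 1, Cross c), (i, Cross c)]
                  [(i + 1, Cross c), (i, Cross c), (i + 1, Cross c)]"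

inductive diagram_move :: "diagram \<Rightarrow> diagram \<Rightarrow> bool" where
  "local_move l r \<Longrightarrow> link_diagram (A @ l @ B) \<Longrightarrow> link_diagram (A @ r @ B)
     \<Longrightarrow> diagram_move (A @ l @ B) (A @ r @ B)"

definition isotopic :: "diagram \<Rightarrow> diagram \<Rightarrow> bool" where
  "isotopic d d' \<longleftrightarrow> link_diagram d \<and> link_diagram d' \<and> equivclp diagram_move d d'"

text \<open>Reflection in the plane of projection.\<close>

fun mirror_piece :: "piece \<Rightarrow> piece" where
  "mirror_piece (Cup a) = Cup a"
| "mirror_piece Cap = Cap"
| "mirror_piece (Cross c) = Cross (\<not> c)"

definition mirror :: "diagram \<Rightarrow> diagram" where
  "mirror d = map (\<lambda>(i, g). (i, mirror_piece g)) d"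


section \<open>The Conway polynomial\<close>

definition unknot :: diagram where
  "unknot = [(0, Cup True), (0, Cap)]"

text \<open>
  With both strands oriented upward (or both downward) \<open>Cross True\<close> is a positive crossing;
  reversing one of the strands changes the sign. If exactly one strand is upward, the smoothing
  compatible with the orientations is a maximum followed by a minimum.
\<close>

inductive skein_triple :: "diagram \<Rightarrow> diagram \<Rightarrow> diagram \<Rightarrow> bool" where
  parallel: "skein_triple (A @ [(i, Cross True)] @ B) (A @ [(i, Cross False)] @ B) (A @ B)"
  if "run A [] = Some s" "i + 1 < length s" "s ! i = s ! (i + 1)"
     "link_diagram (A @ [(i, Cross True)] @ B)"
| antiparallel: "skein_triple (A @ [(i, Cross False)] @ B) (A @ [(i, Cross True)] @ B)
                   (A @ [(i, Cap), (i, Cup (s ! (i + 1)))] @ B)"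
  if "run A [] = Some s" "i + 1 < length s" "s ! i \<noteq> s ! (i + 1)"
     "link_diagram (A @ [(i, Cross True)] @ B)"

text \<open>
  The Conway polynomial is the invariant of oriented (nonempty) links with the following
  properties, which determine it uniquely.
\<close>

definition conway_polynomial :: "(diagram \<Rightarrow> int poly) \<Rightarrow> bool" where
  "conway_polynomial nabla \<longleftrightarrow>
     (\<forall>d d'. isotopic d d' \<longrightarrow> nabla d = nabla d') \<and>
     nabla unknot = 1 \<and>
     (\<forall>dp dm d0. skein_triple dp dm d0 \<longrightarrow> nabla dp - nabla dm = [:0, 1:] * nabla d0)"


section \<open>Two-bridge links\<close>

text \<open>
  The diagram \<open>C(a\<^sub>1, \<dots>, a\<^sub>n)\<close> as a 4-plat: \<open>a\<^sub>1, a\<^sub>3, \<dots>\<close> are the numbers of signed crossings of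
  the two middle strands, \<open>a\<^sub>2, a\<^sub>4, \<dots>\<close> those of the two leftmost strands. In the list \<open>as\<close> the
  indices start at 0, so middle regions have even index. The two kinds of regions use
  opposite conventions, so that the diagram is alternating if all entries have the same sign.

  The strands start with the orientations down, up, down, up. If all entries are even, this
  pattern recurs between the twist regions, so the two strands of each region are antiparallel;
  then an entry \<open>a\<close> at a middle position contributes crossings of sign \<open>sgn a\<close>, at a left
  position crossings of sign \<open>- sgn a\<close>. Only even entries are used below.
\<close>

definition twist_region :: "nat \<Rightarrow> int \<Rightarrow> diagram" where
  "twist_region k a =
     replicate (nat \<bar>a\<bar>) (if even k then (1, Cross (a < 0)) else (0, Cross (a > 0)))"

definition conway_form :: "int list \<Rightarrow> diagram" where
  "conway_form as =
     [(0, Cup False), (2, Cup False)]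
     @ concat (map (\<lambda>k. twist_region k (as ! k)) [0..<length as])
     @ (if odd (length as) then [(0, Cap), (0, Cap)] else [(1, Cap), (0, Cap)])"

text \<open>\<open>two_bridge d\<close>: the diagram represents some \<open>C(2b\<^sub>1, -2b\<^sub>2, \<dots>, (-1)\<^sup>m\<^sup>-\<^sup>1 2b\<^sub>m)\<close>.\<close>

definition two_bridge :: "diagram \<Rightarrow> bool" where
  "two_bridge d \<longleftrightarrow>
     (\<exists>b. 0 \<notin> set b \<and> isotopic d (conway_form (map (\<lambda>k. (-1) ^ k * (2 * b ! k)) [0..<length b])))"

end

theory Submission
  imports Defs
begin

text \<open>
  Only the topology of the last twist region is needed. Its two strands are antiparallel, so
  a crossing change in it removes a full twist, and smoothing a crossing cuts the region into
  a maximum and a minimum: the remaining crossings of the region become curls of the minimum and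
  disappear, and the minimum then straightens against the next maximum, which leaves the link without
  the last region. If the last region has no crossings at all, the region before it lies
  directly under a maximum, so it consists of curls and disappears as well. This gives
  \<open>\<nabla>\<^sub>m = b\<^sub>m z \<nabla>\<^sub>m\<^sub>-\<^sub>1 + \<nabla>\<^sub>m\<^sub>-\<^sub>2\<close> (\<open>conway_plat\<close>); the start of the recursion
  is the unknot and, for \<open>\<nabla>\<^sub>-\<^sub>1 = 0\<close>, the split unlink.

  The recursion makes the coefficient of \<open>z\<^sup>m\<^sup>-\<^sup>2\<^sup>k\<close> a sum of \<open>(m - k) choose k\<close> products, each
  obtained from \<open>b\<^sub>1 \<cdots> b\<^sub>m\<close> by deleting \<open>k\<close> disjoint pairs of neighbours. The \<open>b\<^sub>i\<close> are nonzero
  integers, so no such product exceeds \<open>\<bar>b\<^sub>1 \<cdots> b\<^sub>m\<bar>\<close>. In an induction along the recursion this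
  is Pascal's rule together with the triangle inequality (\<open>continuant_coeff_bound\<close>).

  In the case of equality both estimates are sharp at every step: neighbours have absolute value 1,
  and the two summands have the same sign. Tracing this back (\<open>extremal_split\<close>) shows that
  all \<open>b\<^sub>i\<close> are \<open>\<plusminus>1\<close> and that the sign of \<open>b\<^sub>i b\<^sub>i\<^sub>+\<^sub>1\<close> is the same for all \<open>i\<close>
  (\<open>extremal_imp_unit_geometric\<close>). The condition \<open>k < m div 2\<close> provides room to exchange a deleted
  pair for an overlapping one, which is what compares consecutive signs. For such sequences
  all products have the same value for each \<open>k\<close>, hence equality holds throughout. There are only four
  of them, and they give the two links and their mirror images.
\<close>

section \<open>Reidemeister moves on composite diagrams\<close>

lemma run_append: "run (A @ B) s = Option.bind (run A s) (run B)"
proof (induction A arbitrary: s)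
  case (Cons x A)
  then show ?case by (cases "slice_step x s") simp_all
qed simp

lemma isotopic_trans [trans]: "isotopic d e \<Longrightarrow> isotopic e f \<Longrightarrow> isotopic d f"
  unfolding isotopic_def using equivclp_trans by metis

lemma isotopic_sym: "isotopic d e \<Longrightarrow> isotopic e d"
  unfolding isotopic_def using equivclp_sym by metis

lemma isotopic_refl: "link_diagram d \<Longrightarrow> isotopic d d"
  unfolding isotopic_def by simp

lemma isotopic_local_move:
  assumes "local_move l r" "link_diagram (A @ l @ B)" "link_diagram (A @ r @ B)"
  shows "isotopic (A @ l @ B) (A @ r @ B)"
  unfolding isotopic_def using diagram_move.intros[OF assms] assms by auto

lemma run_curl_cap: "run [(i, Cross c), (i, Cap)] s = run [(i, Cap)] s"
  by (auto simp: nth_append)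

lemma run_curl_cup: "run [(i, Cup a), (i, Cross c)] s = run [(i, Cup (\<not> a))] s"
  by (auto simp: nth_append)

lemma run_double_crossing:
  assumes "i + 1 < length s"
  shows "run [(i, Cross c), (i, Cross d)] s = Some s"
proof -
  have "take i s @ [s ! i, s ! (i + 1)] @ drop (i + 2) s = s"
    using assms by (simp add: Cons_nth_drop_Suc)
  then show ?thesis using assms by (simp add: nth_append)
qed

lemma link_diagram_cong:
  assumes "\<And>s. run l s = run r s"
  shows "link_diagram (A @ l @ B) \<longleftrightarrow> link_diagram (A @ r @ B)"
proof -
  have "run (l @ B) = run (r @ B)" by (rule ext) (simp only: run_append assms)
  then show ?thesis by (simp only: link_diagram_def run_append[of A])
qed

text \<open>
  These two lemmas remove twist regions: once it is closed off on one side, any number of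
  crossings of either kind is undone by first Reidemeister moves. Each curl at a minimum
  exchanges its legs, so an odd number of them reverses its label.
\<close>

lemma isotopic_curls_cap:
  assumes "link_diagram (A @ (i, Cap) # B)"
  shows "isotopic (A @ replicate n (i, Cross c) @ (i, Cap) # B) (A @ (i, Cap) # B)"
proof (induction n)
  case 0
  show ?case using assms by (simp add: isotopic_refl)
next
  case (Suc n)
  let ?A = "A @ replicate n (i, Cross c)"
  have "link_diagram (?A @ [(i, Cap)] @ B)"
    using Suc by (simp add: isotopic_def)
  moreover from this have "link_diagram (?A @ [(i, Cross c), (i, Cap)] @ B)"
    by (subst link_diagram_cong[OF run_curl_cap])
  ultimately have "isotopic (?A @ [(i, Cross c), (i, Cap)] @ B) (?A @ [(i, Cap)] @ B)"
    by (intro isotopic_local_move R1_cap)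
  also have "isotopic (?A @ [(i, Cap)] @ B) (A @ (i, Cap) # B)"
    using Suc by simp
  finally show ?case by (simp add: replicate_app_Cons_same)
qed

lemma isotopic_curls_cup:
  assumes "link_diagram (A @ (i, Cup (a \<noteq> odd n)) # B)"
  shows "isotopic (A @ (i, Cup a) # replicate n (i, Cross c) @ B) (A @ (i, Cup (a \<noteq> odd n)) # B)"
  using assms
proof (induction n arbitrary: a)
  case 0
  then show ?case by (simp add: isotopic_refl)
next
  case (Suc n)
  let ?B = "replicate n (i, Cross c) @ B"
  have IH: "isotopic (A @ [(i, Cup (\<not> a))] @ ?B) (A @ (i, Cup (a \<noteq> odd (Suc n))) # B)"
    using Suc.IH[of "\<not> a"] Suc.prems by auto
  then have "link_diagram (A @ [(i, Cup (\<not> a))] @ ?B)"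
    by (simp add: isotopic_def)
  moreover from this have "link_diagram (A @ [(i, Cup a), (i, Cross c)] @ ?B)"
    by (subst link_diagram_cong[OF run_curl_cup])
  ultimately have "isotopic (A @ [(i, Cup a), (i, Cross c)] @ ?B) (A @ [(i, Cup (\<not> a))] @ ?B)"
    by (intro isotopic_local_move R1_cup)
  from isotopic_trans[OF this IH] show ?case by simp
qed

text \<open>
  A small circle loses its orientation by a flip: a single curl can be absorbed by the maximum,
  which keeps the label of the minimum, or by the minimum, which reverses it.
\<close>

lemma isotopic_circle_reverse:
  assumes "link_diagram (A @ [(i, Cup a), (i, Cap)] @ B)"
    and "link_diagram (A @ [(i, Cup (\<not> a)), (i, Cap)] @ B)"
  shows "isotopic (A @ [(i, Cup a), (i, Cap)] @ B) (A @ [(i, Cup (\<not> a)), (i, Cap)] @ B)"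
proof -
  have "isotopic (A @ [(i, Cup a), (i, Cross True), (i, Cap)] @ B) (A @ [(i, Cup a), (i, Cap)] @ B)"
    (is "isotopic ?curled ?circle")
    using isotopic_curls_cap[of "A @ [(i, Cup a)]" i B 1 True] assms(1) by simp
  then have "isotopic ?circle ?curled"
    by (rule isotopic_sym)
  also have "isotopic ?curled (A @ [(i, Cup (\<not> a)), (i, Cap)] @ B)"
    using isotopic_curls_cup[of A i a 1 "(i, Cap) # B" True] assms(2) by simp
  finally show ?thesis .
qed


section \<open>The Conway polynomial of a twist region\<close>

text \<open>
  In the antiparallel orientation the crossings are positive iff \<open>n\<close> is, at both
  positions of a twist region; the alternating signs in the Conway normal form cancel the
  opposite conventions for middle and left regions.
\<close>

definition full_twists :: "nat \<Rightarrow> int \<Rightarrow> diagram" where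
  "full_twists i n = replicate (2 * nat \<bar>n\<bar>) (i, Cross (n < 0))"

lemma run_even_crossings:
  assumes "i + 1 < length s"
  shows "run (replicate (2 * n) (i, Cross c)) s = Some s"
proof (induction n)
  case (Suc n)
  have "replicate (2 * Suc n) (i, Cross c)
      = [(i, Cross c), (i, Cross c)] @ replicate (2 * n) (i, Cross c)" by simp
  then show ?case
    using Suc run_double_crossing[OF assms] by (simp only: run_append) simp
qed simp

lemma conway_isotopic: "conway_polynomial nabla \<Longrightarrow> isotopic d e \<Longrightarrow> nabla d = nabla e"
  by (simp add: conway_polynomial_def)

lemma conway_skein:
  "conway_polynomial nabla \<Longrightarrow> skein_triple dp dm d0 \<Longrightarrow> nabla dp - nabla dm = [:0, 1:] * nabla d0"
  unfolding conway_polynomial_def by blast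

text \<open>
  The skein relation is applied to the first crossing. Changed, it cancels against the second one.
  Smoothed, it leaves an odd number of curls on the new minimum, whose label thereby
  changes from \<open>s ! (i + 1)\<close> to \<open>s ! i\<close>.
\<close>

lemma conway_add_full_twist:
  assumes nabla: "conway_polynomial nabla"
    and A: "run A [] = Some s" and i: "i + 1 < length s" and anti: "s ! i \<noteq> s ! (i + 1)"
    and link: "link_diagram (A @ B)"
  shows "nabla (A @ replicate (2 * Suc n) (i, Cross c) @ B)
       = nabla (A @ replicate (2 * n) (i, Cross c) @ B)
         + (if c then - 1 else 1) * [:0, 1:] * nabla (A @ [(i, Cap), (i, Cup (s ! i))] @ B)"
proof -
  let ?X = "replicate (2 * n + 1) (i, Cross c) @ B"
  \<comment> \<open>As an opaque factor, the indeterminate does not get evaluated by shifting coefficients.\<close>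
  define z :: "int poly" where "z = [:0, 1:]"
  have B: "run B s = Some []"
    using link A by (simp add: link_diagram_def run_append)
  have even: "run (replicate (2 * n) (i, Cross c) @ B) s = Some []"
    using run_even_crossings[OF i] B by (simp add: run_append)
  have X: "?X = [(i, Cross c)] @ replicate (2 * n) (i, Cross c) @ B"
    by simp
  have link_crossed: "link_diagram (A @ [(i, Cross d)] @ ?X)" for d
  proof -
    have "run ([(i, Cross d), (i, Cross c)] @ replicate (2 * n) (i, Cross c) @ B) s = Some []"
      unfolding run_append[of "[(i, Cross d), (i, Cross c)]"] run_double_crossing[OF i]
      using even by simp
    then show ?thesis using A X by (simp add: link_diagram_def run_append)
  qed
  have smooth: "nabla (A @ [(i, Cap), (i, Cup (s ! (i + 1)))] @ ?X)
      = nabla (A @ [(i, Cap), (i, Cup (s ! i))] @ B)"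
  proof -
    have eq: "(s ! (i + 1) \<noteq> odd (2 * n + 1)) = s ! i" using anti by auto
    have "take i s @ [s ! i, s ! (i + 1)] @ drop (i + 2) s = s"
      using i by (simp add: Cons_nth_drop_Suc)
    moreover have "(\<not> s ! i) = s ! (i + 1)"
      using anti by auto
    ultimately have "run [(i, Cap), (i, Cup (s ! i))] s = Some s"
      using i anti by (simp add: min_def)
    then have "run ([(i, Cap), (i, Cup (s ! i))] @ B) s = Some []"
      using B by (simp only: run_append bind.bind_lunit)
    then have "link_diagram ((A @ [(i, Cap)]) @ (i, Cup (s ! (i + 1) \<noteq> odd (2 * n + 1))) # B)"
      unfolding eq
      by (simp only: link_diagram_def append_assoc append.simps run_append[of A] A bind.bind_lunit)
    from conway_isotopic[OF nabla isotopic_curls_cup[OF this, of c]] show ?thesis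
      unfolding eq by simp
  qed
  have "skein_triple (A @ [(i, Cross False)] @ ?X) (A @ [(i, Cross True)] @ ?X)
      (A @ [(i, Cap), (i, Cup (s ! (i + 1)))] @ ?X)"
    using A i anti link_crossed by (intro skein_triple.antiparallel)
  note skein = conway_skein[OF nabla this, unfolded smooth, folded z_def]
  have "link_diagram (A @ [] @ replicate (2 * n) (i, Cross c) @ B)"
    using even A by (simp add: link_diagram_def run_append)
  then have "isotopic (A @ [(i, Cross (\<not> c)), (i, Cross (\<not> \<not> c))] @ replicate (2 * n) (i, Cross c) @ B)
      (A @ [] @ replicate (2 * n) (i, Cross c) @ B)"
    using link_crossed[of "\<not> c"] X by (intro isotopic_local_move R2) simp_all
  from conway_isotopic[OF nabla this]
  have cancel: "nabla (A @ [(i, Cross (\<not> c))] @ ?X) = nabla (A @ replicate (2 * n) (i, Cross c) @ B)"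
    by simp
  have same: "A @ replicate (2 * Suc n) (i, Cross c) @ B = A @ [(i, Cross c)] @ ?X"
    by simp
  show ?thesis
    unfolding same z_def[symmetric] using skein cancel by (cases c) (simp_all add: algebra_simps)
qed

text \<open>The smoothed link does not depend on the number of twists, so the contributions add up.\<close>

lemma conway_full_twists:
  assumes "conway_polynomial nabla"
    and "run A [] = Some s" and "i + 1 < length s" and "s ! i \<noteq> s ! (i + 1)"
    and "link_diagram (A @ B)"
  shows "nabla (A @ full_twists i n @ B)
       = nabla (A @ B) + [:0, n:] * nabla (A @ [(i, Cap), (i, Cup (s ! i))] @ B)"
proof -
  have *: "nabla (A @ replicate (2 * N) (i, Cross c) @ B) = nabla (A @ B)
      + [:0, (if c then - 1 else 1) * int N:] * nabla (A @ [(i, Cap), (i, Cup (s ! i))] @ B)" for N c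
  proof (induction N)
    case (Suc N)
    show ?case
      unfolding conway_add_full_twist[OF assms] Suc by (simp add: algebra_simps smult_add_left)
  qed simp
  show ?thesis
    unfolding full_twists_def * by simp
qed


section \<open>The Conway polynomial of a two-bridge link\<close>

text \<open>
  The first \<open>m\<close> twist regions are separated from the closing maxima because the recursion meets
  both closings, \<open>plat_top m\<close> and \<open>plat_top (Suc m)\<close>, on top of the same regions.
\<close>

definition plat_bottom :: "(nat \<Rightarrow> int) \<Rightarrow> nat \<Rightarrow> diagram" where
  "plat_bottom b m = [(0, Cup False), (2, Cup False)]
     @ concat (map (\<lambda>k. full_twists (if even k then 1 else 0) (b k)) [0..<m])"

definition plat_top :: "nat \<Rightarrow> diagram" where
  "plat_top m = (if odd m then [(0, Cap), (0, Cap)] else [(1, Cap), (0, Cap)])"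

lemma twist_region_even:
  "twist_region k ((-1) ^ k * (2 * n)) = full_twists (if even k then 1 else 0) n"
proof -
  have "nat \<bar>2 * n\<bar> = 2 * nat \<bar>n\<bar>" by (simp add: abs_mult nat_mult_distrib)
  then show ?thesis
    by (cases "n = 0") (auto simp: twist_region_def full_twists_def abs_mult)
qed

lemma conway_form_plat:
  "conway_form (map (\<lambda>k. (-1) ^ k * (2 * b k)) [0..<m]) = plat_bottom b m @ plat_top m"
proof -
  let ?as = "map (\<lambda>k. (-1) ^ k * (2 * b k)) [0..<m]"
  have regions: "map (\<lambda>k. twist_region k (?as ! k)) [0..<length ?as]
      = map (\<lambda>k. full_twists (if even k then 1 else 0) (b k)) [0..<m]"
    by (auto simp: twist_region_even)
  show ?thesis
    unfolding conway_form_def regions plat_bottom_def plat_top_def by simp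
qed

lemma plat_bottom_Suc:
  "plat_bottom b (Suc m) = plat_bottom b m @ full_twists (if even m then 1 else 0) (b m)"
  by (simp add: plat_bottom_def)

lemma run_plat_bottom: "run (plat_bottom b m) [] = Some [False, True, False, True]"
proof (induction m)
  case 0
  show ?case by (simp add: plat_bottom_def)
next
  case (Suc m)
  have "run (full_twists (if even m then 1 else 0) (b m)) [False, True, False, True]
      = Some [False, True, False, True]"
    unfolding full_twists_def by (rule run_even_crossings) simp
  then show ?case
    using Suc by (simp add: plat_bottom_Suc run_append)
qed

lemma link_diagram_plat: "link_diagram (plat_bottom b m @ plat_top n)"
  by (cases "odd n")
    (simp_all add: link_diagram_def run_append[of "plat_bottom b m"] run_plat_bottom plat_top_def)

text \<open>
  The two crossing signs of a figure eight diagram both give an unknot, so the skein relation kills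
  the unlink obtained by smoothing. The circles, one above the other after the smoothing,
  are then moved side by side.
\<close>

lemma conway_unlink:
  assumes "conway_polynomial nabla"
  shows "nabla (plat_bottom b 0 @ plat_top 1) = 0"
proof -
  have curl: "nabla [(0, Cup False), (0, Cross c), (0, Cap)] = nabla [(0, Cup True), (0, Cap)]" for c
    using conway_isotopic[OF assms isotopic_local_move[OF R1_cup[of 0 False c], of "[]" "[(0, Cap)]"]]
    by (simp add: link_diagram_def)
  have "skein_triple ([(0, Cup False)] @ [(0, Cross False)] @ [(0, Cap)])
      ([(0, Cup False)] @ [(0, Cross True)] @ [(0, Cap)])
      ([(0, Cup False)] @ [(0, Cap), (0, Cup ([False, True] ! (0 + 1)))] @ [(0, Cap)])"
    by (intro skein_triple.antiparallel) (simp_all add: link_diagram_def)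
  from conway_skein[OF assms this]
  have "0 = nabla [(0, Cup False), (0, Cap), (0, Cup True), (0, Cap)]"
    by (simp add: curl)
  also have "\<dots> = nabla [(0, Cup False), (0, Cap), (0, Cup False), (0, Cap)]"
    using conway_isotopic[OF assms isotopic_circle_reverse
        [of "[(0, Cup False), (0, Cap)]" 0 True "[]"]]
    by (simp add: link_diagram_def)
  also have "\<dots> = nabla (plat_bottom b 0 @ plat_top 1)"
    using conway_isotopic[OF assms isotopic_local_move
        [OF exchange[of 0 Cap 0 "Cup False"], of "[(0, Cup False)]" "[(0, Cap)]"]]
    by (simp add: link_diagram_def plat_bottom_def plat_top_def numeral_2_eq_2)
  finally show ?thesis by simp
qed

text \<open>
  The minimum created by the smoothing and the maximum above it form a zigzag, to the left
  or to the right depending on the parity; what remains is \<open>plat_top m\<close>.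
\<close>

lemma conway_plat_Suc:
  assumes "conway_polynomial nabla"
  shows "nabla (plat_bottom b (Suc m) @ plat_top (Suc m))
       = nabla (plat_bottom b m @ plat_top (Suc m)) + [:0, b m:] * nabla (plat_bottom b m @ plat_top m)"
proof -
  define i where "i = (if even m then 1 else 0 :: nat)"
  define s where "s = [False, True, False, True]"
  define l :: diagram where "l = (if even m then [(1, Cup (s ! i)), (0, Cap)] else [(0, Cup (s ! i)), (1, Cap)])"
  let ?P = "plat_bottom b m"
  let ?smoothed = "?P @ [(i, Cap), (i, Cup (s ! i))] @ plat_top (Suc m)"
  have zigzag: "local_move l []"
    using zigzag_left[of 0 "s ! i"] zigzag_right[of 0 "s ! i"]
    by (cases "even m") (simp_all add: l_def i_def)
  have smoothed: "(?P @ [(i, Cap)]) @ l @ [(0, Cap)] = ?smoothed"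
    by (simp add: l_def i_def plat_top_def)
  have straightened: "(?P @ [(i, Cap)]) @ [] @ [(0, Cap)] = ?P @ plat_top m"
    by (simp add: i_def plat_top_def)
  have "run ([(i, Cap), (i, Cup (s ! i))] @ plat_top (Suc m)) s = Some []"
    by (cases "even m") (simp_all add: i_def s_def plat_top_def)
  then have "link_diagram ?smoothed"
    by (simp only: link_diagram_def run_append[of ?P] run_plat_bottom s_def bind.bind_lunit)
  then have "isotopic ?smoothed (?P @ plat_top m)"
    using isotopic_local_move[OF zigzag, of "?P @ [(i, Cap)]" "[(0, Cap)]",
        unfolded smoothed straightened] link_diagram_plat[of b m m]
    by (simp only:)
  then have smooth: "nabla ?smoothed = nabla (?P @ plat_top m)"
    by (rule conway_isotopic[OF assms])
  have "i + 1 < length s" and "s ! i \<noteq> s ! (i + 1)"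
    by (simp_all add: i_def s_def)
  from conway_full_twists[OF assms run_plat_bottom[of b m, folded s_def] this
      link_diagram_plat[of b m "Suc m"], of "b m"]
  have "nabla ((?P @ full_twists i (b m)) @ plat_top (Suc m))
      = nabla (?P @ plat_top (Suc m)) + [:0, b m:] * nabla (?P @ plat_top m)"
    unfolding smooth append_assoc .
  moreover have "plat_bottom b (Suc m) = ?P @ full_twists i (b m)"
    unfolding i_def by (rule plat_bottom_Suc)
  ultimately show ?thesis by (simp only:)
qed

text \<open>With the closing of \<open>m\<close> regions, the additional region \<open>m\<close> lies directly below a maximum.\<close>

lemma isotopic_plat_untwist:
  "isotopic (plat_bottom b (Suc m) @ plat_top m) (plat_bottom b m @ plat_top m)"
proof -
  have "plat_top m = ((if even m then 1 else 0), Cap) # [(0, Cap)]"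
    by (simp add: plat_top_def)
  then show ?thesis
    using isotopic_curls_cap[of "plat_bottom b m" "if even m then 1 else 0" "[(0, Cap)]"]
      link_diagram_plat[of b m m]
    by (simp add: plat_bottom_Suc full_twists_def)
qed

lemma isotopic_plat_unknot: "isotopic (plat_bottom b 0 @ plat_top 0) unknot"
proof -
  have "isotopic (plat_bottom b 0 @ plat_top 0) [(0, Cup False), (0, Cap)]"
    using isotopic_local_move[OF zigzag_left[of 1 False], of "[(0, Cup False)]" "[(0, Cap)]"]
    by (simp add: link_diagram_def plat_bottom_def plat_top_def numeral_2_eq_2)
  also have "isotopic [(0, Cup False), (0, Cap)] unknot"
    using isotopic_circle_reverse[of "[]" 0 False "[]"] by (simp add: link_diagram_def unknot_def)
  finally show ?thesis .
qed

lemma conway_plat_0: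
  assumes "conway_polynomial nabla"
  shows "nabla (plat_bottom b 0 @ plat_top 0) = 1"
proof -
  have "nabla unknot = 1"
    using assms unfolding conway_polynomial_def by blast
  then show ?thesis
    using conway_isotopic[OF assms isotopic_plat_unknot] by simp
qed


section \<open>Continuants\<close>

fun continuant :: "(nat \<Rightarrow> int) \<Rightarrow> nat \<Rightarrow> int poly" where
  "continuant b 0 = 1"
| "continuant b (Suc 0) = [:0, b 0:]"
| "continuant b (Suc (Suc m)) = [:0, b (Suc m):] * continuant b (Suc m) + continuant b m"

lemma conway_plat:
  assumes "conway_polynomial nabla"
  shows "nabla (plat_bottom b m @ plat_top m) = continuant b m"
proof (induction b m rule: continuant.induct)
  case (1 b)
  show ?case
    using conway_plat_0[OF assms] by simp
next
  case (2 b)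
  have "nabla (plat_bottom b 0 @ plat_top 0) = 1"
    by (rule conway_plat_0[OF assms])
  then show ?case
    using conway_plat_Suc[OF assms, of b 0] conway_unlink[OF assms, of b] by simp
next
  case (3 b m)
  have "plat_top (Suc (Suc m)) = plat_top m"
    by (simp add: plat_top_def)
  then show ?case
    using conway_plat_Suc[OF assms, of b "Suc m"] 3
      conway_isotopic[OF assms isotopic_plat_untwist, of b m]
    by simp
qed

text \<open>
  The coefficients are indexed by the number of deleted pairs: \<open>continuant_coeff b m k\<close> belongs to
  the power \<open>m - 2 * k\<close>.
\<close>

fun continuant_coeff :: "(nat \<Rightarrow> int) \<Rightarrow> nat \<Rightarrow> nat \<Rightarrow> int" where
  "continuant_coeff b 0 k = (if k = 0 then 1 else 0)"
| "continuant_coeff b (Suc 0) k = (if k = 0 then b 0 else 0)"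
| "continuant_coeff b (Suc (Suc m)) k = b (Suc m) * continuant_coeff b (Suc m) k
     + (if k = 0 then 0 else continuant_coeff b m (k - 1))"

lemma continuant_coeff_0: "continuant_coeff b m 0 = (\<Prod>j<m. b j)"
  by (induction b m "0 :: nat" rule: continuant_coeff.induct) (simp_all add: mult.commute)

lemma continuant_coeff_large: "m < 2 * k \<Longrightarrow> continuant_coeff b m k = 0"
  by (induction b m k rule: continuant_coeff.induct) auto

lemma continuant_eq_sum:
  "continuant b m = (\<Sum>k\<le>m div 2. monom (continuant_coeff b m k) (m - 2 * k))"
proof (induction b m rule: continuant.induct)
  case (1 b)
  show ?case by (simp add: monom_0 one_pCons)
next
  case (2 b)
  show ?case by (simp add: monom_Suc monom_0)
next
  case (3 b m)
  let ?c = "continuant_coeff b"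
  have "[:0, b (Suc m):] * continuant b (Suc m)
      = (\<Sum>k\<le>Suc m div 2. monom (b (Suc m) * ?c (Suc m) k) (Suc (Suc m) - 2 * k))"
    unfolding 3 sum_distrib_left
  proof (intro sum.cong refl)
    fix k assume "k \<in> {..Suc m div 2}"
    then have "Suc (Suc m) - 2 * k = Suc (Suc m - 2 * k)" by auto
    then show "[:0, b (Suc m):] * monom (?c (Suc m) k) (Suc m - 2 * k)
        = monom (b (Suc m) * ?c (Suc m) k) (Suc (Suc m) - 2 * k)"
      by (simp add: monom_Suc smult_monom)
  qed
  also have "\<dots> = (\<Sum>k\<le>Suc (m div 2). monom (b (Suc m) * ?c (Suc m) k) (Suc (Suc m) - 2 * k))"
  proof (intro sum.mono_neutral_left)
    have "?c (Suc m) k = 0" if "\<not> k \<le> Suc m div 2" for k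
      using that by (intro continuant_coeff_large) linarith
    then show "\<forall>k\<in>{..Suc (m div 2)} - {..Suc m div 2}.
        monom (b (Suc m) * ?c (Suc m) k) (Suc (Suc m) - 2 * k) = 0" by simp
  qed auto
  also have "\<dots> + continuant b m = (\<Sum>k\<le>Suc (m div 2). monom (?c (Suc (Suc m)) k) (Suc (Suc m) - 2 * k))"
    unfolding 3 sum.atMost_Suc_shift by (simp add: sum.distrib[symmetric] add_monom algebra_simps)
  finally show ?case by simp
qed

lemma coeff_continuant: "k \<le> m div 2 \<Longrightarrow> coeff (continuant b m) (m - 2 * k) = continuant_coeff b m k"
proof -
  assume k: "k \<le> m div 2"
  have "coeff (continuant b m) (m - 2 * k)
      = (\<Sum>j\<le>m div 2. if j = k then continuant_coeff b m j else 0)"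
    unfolding continuant_eq_sum coeff_sum coeff_monom using k by (intro sum.cong) auto
  then show ?thesis using k by simp
qed

lemma degree_continuant:
  assumes "\<And>j. j < m \<Longrightarrow> b j \<noteq> 0"
  shows "degree (continuant b m) = m"
proof (rule antisym)
  show "degree (continuant b m) \<le> m"
    unfolding continuant_eq_sum
    by (intro degree_sum_le) (auto intro: order_trans[OF degree_monom_le])
  have "coeff (continuant b m) m \<noteq> 0"
    using coeff_continuant[of 0 m b] assms by (simp add: continuant_coeff_0)
  then show "m \<le> degree (continuant b m)"
    by (rule le_degree)
qed


section \<open>The coefficient bound and its case of equality\<close>

lemma choose_recursion:
  "(Suc (Suc m) - Suc k) choose Suc k = ((Suc m - Suc k) choose Suc k) + ((m - k) choose k)"
  by (cases "k \<le> m") (simp_all add: Suc_diff_le)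

lemma continuant_coeff_Suc_Suc:
  "continuant_coeff b (Suc (Suc m)) (Suc k)
     = b (Suc m) * continuant_coeff b (Suc m) (Suc k) + continuant_coeff b m k"
  by simp

lemma abs_prod_Suc_Suc:
  fixes b :: "nat \<Rightarrow> int"
  shows "\<bar>\<Prod>j<Suc (Suc m). b j\<bar> = \<bar>b (Suc m)\<bar> * \<bar>\<Prod>j<Suc m. b j\<bar>"
    and "\<bar>\<Prod>j<Suc (Suc m). b j\<bar> = \<bar>b m * b (Suc m)\<bar> * \<bar>\<Prod>j<m. b j\<bar>"
  by (simp_all add: abs_mult)

text \<open>
  The two summands of the recursion match the two summands of Pascal's rule: keeping the last entry
  multiplies both sides by its absolute value, and deleting the last pair loses a factor of
  absolute value at least 1.
\<close>

lemma continuant_coeff_bound: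
  assumes "\<And>j. j < m \<Longrightarrow> b j \<noteq> 0"
  shows "\<bar>continuant_coeff b m k\<bar> \<le> int ((m - k) choose k) * \<bar>\<Prod>j<m. b j\<bar>"
  using assms
proof (induction b m k rule: continuant_coeff.induct)
  case (3 b m k)
  show ?case
  proof (cases k)
    case 0
    then show ?thesis by (simp add: continuant_coeff_0 abs_mult)
  next
    case (Suc l)
    let ?P = "\<lambda>m. \<bar>\<Prod>j<m. b j\<bar>"
    have "\<bar>continuant_coeff b (Suc (Suc m)) k\<bar>
        \<le> \<bar>b (Suc m)\<bar> * \<bar>continuant_coeff b (Suc m) (Suc l)\<bar> + \<bar>continuant_coeff b m l\<bar>"
      unfolding Suc continuant_coeff_Suc_Suc abs_mult[symmetric] by (rule abs_triangle_ineq)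
    also have "\<dots> \<le> \<bar>b (Suc m)\<bar> * (int ((Suc m - Suc l) choose Suc l) * ?P (Suc m))
        + int ((m - l) choose l) * ?P m"
      using 3 Suc by (intro add_mono mult_left_mono) auto
    also have "?P m \<le> ?P (Suc (Suc m))"
    proof -
      have "b m * b (Suc m) \<noteq> 0" using 3(3)[of m] 3(3)[of "Suc m"] by simp
      then have "1 \<le> \<bar>b m * b (Suc m)\<bar>" by linarith
      from mult_right_mono[OF this, of "?P m"] show ?thesis
        unfolding abs_prod_Suc_Suc(2) by simp
    qed
    also have "\<bar>b (Suc m)\<bar> * (int ((Suc m - Suc l) choose Suc l) * ?P (Suc m))
        = int ((Suc m - Suc l) choose Suc l) * ?P (Suc (Suc m))"
      unfolding abs_prod_Suc_Suc(1) by (simp add: mult_ac)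
    finally show ?thesis
      unfolding Suc choose_recursion by (simp add: mult_left_mono distrib_right)
  qed
qed simp_all

definition extremal :: "(nat \<Rightarrow> int) \<Rightarrow> nat \<Rightarrow> nat \<Rightarrow> bool" where
  "extremal b m k \<longleftrightarrow> \<bar>continuant_coeff b m k\<bar> = int ((m - k) choose k) * \<bar>\<Prod>j<m. b j\<bar>"

text \<open>
  Up to the choice of \<open>b 0 = \<plusminus>1\<close>, the ratio \<open>e\<close> determines the sequence: it is constant for
  \<open>e = 1\<close> and alternating for \<open>e = - 1\<close>.
\<close>

definition unit_geometric :: "(nat \<Rightarrow> int) \<Rightarrow> nat \<Rightarrow> int \<Rightarrow> bool" where
  "unit_geometric b m e \<longleftrightarrow>
     \<bar>e\<bar> = 1 \<and> (\<forall>j<m. \<bar>b j\<bar> = 1) \<and> (\<forall>j. Suc j < m \<longrightarrow> b (Suc j) = e * b j)"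

lemma unit_square: "\<bar>x :: int\<bar> = 1 \<Longrightarrow> x * x = 1"
  by (auto simp: abs_if split: if_splits)

text \<open>Deleting a pair of neighbours means dividing the product by \<open>e\<close>, that is, multiplying by \<open>e\<close>.\<close>

lemma continuant_coeff_unit_geometric:
  assumes "unit_geometric b m e"
  shows "continuant_coeff b m k = e ^ k * int ((m - k) choose k) * (\<Prod>j<m. b j)"
  using assms
proof (induction b m k rule: continuant_coeff.induct)
  case (1 b k)
  show ?case by (cases k) simp_all
next
  case (2 b k)
  show ?case by (cases k) simp_all
next
  case (3 b m k)
  show ?case
  proof (cases k)
    case 0
    then show ?thesis by (simp only: continuant_coeff_0) simp
  next
    case (Suc l)
    have e: "e * e = 1" and bm: "b m * b m = 1" and b: "b (Suc m) = e * b m"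
      using 3(3) unit_square by (auto simp: unit_geometric_def)
    have P: "(\<Prod>j<m. b j) = e * (\<Prod>j<Suc (Suc m). b j)"
    proof -
      have "e * (\<Prod>j<Suc (Suc m). b j) = (e * e) * (b m * b m) * (\<Prod>j<m. b j)"
        by (simp add: b mult_ac)
      then show ?thesis by (simp add: e bm)
    qed
    have "continuant_coeff b (Suc m) (Suc l)
        = e ^ Suc l * int ((Suc m - Suc l) choose Suc l) * (\<Prod>j<Suc m. b j)"
      and "continuant_coeff b m l = e ^ l * int ((m - l) choose l) * (\<Prod>j<m. b j)"
      using 3 Suc by (auto simp: unit_geometric_def)
    then show ?thesis
      unfolding Suc continuant_coeff_Suc_Suc choose_recursion
      by (simp only: P) (simp add: algebra_simps)
  qed
qed

lemma extremal_unit_geometric: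
  assumes "unit_geometric b m e"
  shows "extremal b m k"
proof -
  have "\<bar>e\<bar> = 1" using assms by (simp add: unit_geometric_def)
  then show ?thesis
    by (simp add: extremal_def continuant_coeff_unit_geometric[OF assms] abs_mult power_abs)
qed

text \<open>
  Equality is inherited by both terms of the recursion, since the binomial coefficients add up exactly.
  The factor lost by deleting the last pair must be 1 because the smaller
  coefficient comes with a positive binomial coefficient; this is where \<open>2 * k \<le> m\<close> enters.
  The last claim is equality in the triangle inequality.
\<close>

lemma extremal_split:
  assumes nz: "\<And>j. j < Suc (Suc m) \<Longrightarrow> b j \<noteq> 0" and k: "2 * k \<le> m"
    and ex: "extremal b (Suc (Suc m)) (Suc k)"
  shows "extremal b (Suc m) (Suc k)" and "extremal b m k"
    and "\<bar>b m\<bar> = 1" and "\<bar>b (Suc m)\<bar> = 1"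
    and "0 \<le> b (Suc m) * continuant_coeff b (Suc m) (Suc k) * continuant_coeff b m k"
proof -
  let ?P = "\<lambda>m. \<bar>\<Prod>j<m. b j\<bar>"
  define X where "X = b (Suc m) * continuant_coeff b (Suc m) (Suc k)"
  define Y where "Y = continuant_coeff b m k"
  define C where "C = int ((Suc m - Suc k) choose Suc k)"
  define D where "D = int ((m - k) choose k)"
  have D: "0 < D" using k by (simp add: D_def)
  have P: "0 < ?P m" using nz by auto
  have "\<bar>continuant_coeff b (Suc m) (Suc k)\<bar> \<le> C * ?P (Suc m)"
    unfolding C_def using nz by (intro continuant_coeff_bound) simp
  then have X: "\<bar>X\<bar> \<le> C * ?P (Suc (Suc m))"
    unfolding X_def abs_prod_Suc_Suc(1) abs_mult[of "b (Suc m)"]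
    by (metis abs_ge_zero mult.left_commute mult_left_mono)
  have Y: "\<bar>Y\<bar> \<le> D * ?P m"
    unfolding Y_def D_def using nz by (intro continuant_coeff_bound) simp
  have "b m * b (Suc m) \<noteq> 0" using nz[of m] nz[of "Suc m"] by simp
  then have b: "1 \<le> \<bar>b m * b (Suc m)\<bar>" by linarith
  have PP: "?P m \<le> ?P (Suc (Suc m))"
    using mult_right_mono[OF b, of "?P m"] unfolding abs_prod_Suc_Suc(2) by simp
  then have DP: "D * ?P m \<le> D * ?P (Suc (Suc m))"
    using D by (simp add: mult_left_mono)
  have XY: "\<bar>X + Y\<bar> = C * ?P (Suc (Suc m)) + D * ?P (Suc (Suc m))"
    using ex unfolding extremal_def continuant_coeff_Suc_Suc choose_recursion X_def Y_def C_def D_def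
    by (simp add: distrib_right)
  note bounds = X Y DP XY abs_triangle_ineq[of X Y]
  have eqX: "\<bar>X\<bar> = C * ?P (Suc (Suc m))" using bounds by linarith
  have eqY: "\<bar>Y\<bar> = D * ?P m" using bounds by linarith
  have eqP: "D * ?P m = D * ?P (Suc (Suc m))" using bounds by linarith
  have add: "\<bar>X + Y\<bar> = \<bar>X\<bar> + \<bar>Y\<bar>" using bounds by linarith
  show "extremal b m k" using eqY by (simp add: extremal_def Y_def D_def)
  have unit: "\<bar>b m * b (Suc m)\<bar> = 1"
    using eqP D P unfolding abs_prod_Suc_Suc(2) by simp
  show "\<bar>b m\<bar> = 1"
    using unit by (rule abs_zmult_eq_1)
  show bS: "\<bar>b (Suc m)\<bar> = 1"
    using unit unfolding mult.commute[of "b m"] by (rule abs_zmult_eq_1)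
  show "extremal b (Suc m) (Suc k)"
    using eqX unfolding extremal_def X_def C_def abs_prod_Suc_Suc(1) abs_mult[of "b (Suc m)"] bS by simp
  have "0 \<le> X * Y" using add by (simp add: zero_le_mult_iff) linarith
  then show "0 \<le> b (Suc m) * continuant_coeff b (Suc m) (Suc k) * continuant_coeff b m k"
    by (simp add: X_def Y_def)
qed

text \<open>
  On a sequence of this kind both coefficients are known explicitly. They differ in sign by the factor
  \<open>e * b m\<close>, so the agreement of signs leaves only \<open>b (Suc m) = e * b m\<close>.
  The bound on \<open>k\<close> excludes that the first coefficient vanishes.
\<close>

lemma unit_geometric_extend:
  assumes g: "unit_geometric b (Suc m) e" and b: "\<bar>b (Suc m)\<bar> = 1" and k: "2 * Suc k \<le> Suc m"
    and sign: "0 \<le> b (Suc m) * continuant_coeff b (Suc m) (Suc k) * continuant_coeff b m k"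
  shows "unit_geometric b (Suc (Suc m)) e"
proof -
  define p where "p = int ((m - k) choose Suc k) * int ((m - k) choose k)"
  let ?P = "\<Prod>j<m. b j"
  have e: "\<bar>e\<bar> = 1" and bm: "\<bar>b m\<bar> = 1" and gm: "unit_geometric b m e" and "\<forall>j<m. \<bar>b j\<bar> = 1"
    using g by (auto simp: unit_geometric_def)
  then have P: "?P * ?P = 1"
    by (intro unit_square) (simp add: abs_prod)
  have ek: "e ^ k * e ^ k = 1"
    using e by (intro unit_square) (simp add: power_abs)
  have "b (Suc m) * continuant_coeff b (Suc m) (Suc k) * continuant_coeff b m k
      = p * (e * b m * b (Suc m)) * ((e ^ k * e ^ k) * (?P * ?P))"
    unfolding continuant_coeff_unit_geometric[OF g] continuant_coeff_unit_geometric[OF gm]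
    by (simp add: p_def mult_ac)
  then have "0 \<le> p * (e * b m * b (Suc m))"
    using sign by (simp only: P ek mult_1_right)
  moreover have "0 < p" using k by (simp add: p_def)
  ultimately have "0 \<le> e * b m * b (Suc m)"
    using mult_pos_neg[of p "e * b m * b (Suc m)"] by linarith
  then have "b (Suc m) = e * b m"
    using e bm b by (auto simp: abs_if split: if_splits)
  then show ?thesis
    using g b unfolding unit_geometric_def by (auto simp: less_Suc_eq)
qed

text \<open>
  For a single deleted pair the ratio is found at the bottom, where any two signs form a
  sequence of the required kind; then it propagates upwards.
\<close>

lemma extremal_1_imp_unit_geometric:
  assumes "extremal b (Suc (Suc m)) 1" and "\<And>j. j < Suc (Suc m) \<Longrightarrow> b j \<noteq> 0"
  shows "\<exists>e. unit_geometric b (Suc (Suc m)) e"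
  using assms
proof (induction m)
  case 0
  then have "\<bar>b 0\<bar> = 1" "\<bar>b 1\<bar> = 1"
    using extremal_split[of 0 b 0] by auto
  then have "unit_geometric b 2 (b 0 * b 1)"
    using unit_square[of "b 0"] by (auto simp: unit_geometric_def abs_mult less_2_cases_iff mult_ac)
  then show ?case by (auto simp: numeral_2_eq_2)
next
  case (Suc m)
  have *: "extremal b (Suc (Suc (Suc m))) (Suc 0)" using Suc by simp
  note split = extremal_split[OF Suc.prems(2) _ *, simplified]
  obtain e where "unit_geometric b (Suc (Suc m)) e"
    using Suc split(1) by auto
  from unit_geometric_extend[OF this split(4), of 0] split(5) show ?case by auto
qed

text \<open>
  Deleting the last pair preserves the condition \<open>k < m div 2\<close>, so the induction hypothesis
  applies to \<open>m - 2\<close> and \<open>k - 1\<close>. The two missing entries are then recovered one after the other, which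
  requires extremality for \<open>m - 1\<close> in between.
\<close>

lemma extremal_imp_unit_geometric:
  assumes "extremal b m k" and "0 < k" and "k < m div 2" and "\<And>j. j < m \<Longrightarrow> b j \<noteq> 0"
  shows "\<exists>e. unit_geometric b m e"
  using assms(2,1,3,4)
proof (induction k arbitrary: m rule: nat_induct_non_zero)
  case 1
  then have "m = Suc (Suc (m - 2))" by auto
  then obtain n where "m = Suc (Suc n)" ..
  then show ?case using 1 extremal_1_imp_unit_geometric by auto
next
  case (Suc k)
  obtain n where m: "m = Suc (Suc (Suc n))" and n: "2 * Suc k \<le> Suc n"
  proof
    show "m = Suc (Suc (Suc (m - 3)))" "2 * Suc k \<le> Suc (m - 3)" using Suc.prems by auto
  qed
  have nz: "j < Suc (Suc (Suc n)) \<Longrightarrow> b j \<noteq> 0" for j using Suc.prems m by auto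
  have k: "2 * k \<le> Suc n" "2 * k \<le> n" "k < Suc n div 2" "2 * Suc k \<le> Suc (Suc n)"
    using n by auto
  note outer = extremal_split[OF nz k(1) Suc.prems(1)[unfolded m]]
  note inner = extremal_split[OF _ k(2) outer(1)]
  have nz': "j < Suc (Suc n) \<Longrightarrow> b j \<noteq> 0" and nz'': "j < Suc n \<Longrightarrow> b j \<noteq> 0" for j
    using nz by simp_all
  obtain e where "unit_geometric b (Suc n) e"
    using Suc.IH[OF outer(2) k(3) nz''] by blast
  then have "unit_geometric b (Suc (Suc n)) e"
    using outer(3) n inner(5)[OF nz'] by (rule unit_geometric_extend)
  then have "unit_geometric b (Suc (Suc (Suc n))) e"
    using outer(4) k(4) outer(5) by (rule unit_geometric_extend)
  then show ?case using m by auto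
qed


section \<open>The extremal links\<close>

lemma mirror_conway_form: "mirror (conway_form as) = conway_form (map uminus as)"
proof -
  have region: "map (\<lambda>(i, g). (i, mirror_piece g)) (twist_region k a) = twist_region k (- a)" for k a
    by (cases "a = 0") (auto simp: twist_region_def)
  have regions: "map (\<lambda>k. twist_region k (map uminus as ! k)) [0..<length as]
      = map (\<lambda>k. twist_region k (- as ! k)) [0..<length as]"
    by simp
  show ?thesis
    unfolding conway_form_def length_map regions
    by (simp add: mirror_def map_concat region o_def)
qed

lemma conway_form_unit_geometric:
  assumes "unit_geometric b m e"
  shows "\<exists>K \<in> {conway_form (map (\<lambda>k. (-1) ^ k * 2) [0..<m]), conway_form (replicate m 2)}.
     conway_form (map (\<lambda>k. (-1) ^ k * (2 * b k)) [0..<m]) \<in> {K, mirror K}"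
proof (cases m)
  case (Suc n)
  define a where "a = b 0"
  have e: "e = 1 \<or> e = -1" and a: "a = 1 \<or> a = -1"
    using assms Suc by (auto simp: unit_geometric_def a_def abs_if split: if_splits)
  have b: "b j = e ^ j * a" if "j < m" for j
    using that
  proof (induction j)
    case (Suc j)
    then have "b (Suc j) = e * b j" using assms by (simp add: unit_geometric_def)
    then show ?case using Suc by simp
  qed (simp add: a_def)
  let ?K1 = "map (\<lambda>k. (-1) ^ k * 2) [0..<m]" and ?K2 = "replicate m (2 :: int)"
  have square: "(-1) ^ k * ((-1) ^ k * x) = (x :: int)" for k x
    by (simp add: mult.assoc[symmetric] power_mult_distrib[symmetric])
  have "map (\<lambda>k. (-1) ^ k * (2 * b k)) [0..<m] = map (\<lambda>k. (-1) ^ k * (e ^ k * (2 * a))) [0..<m]"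
    using b by simp
  also have "\<dots> \<in> {?K1, map uminus ?K1, ?K2, map uminus ?K2}"
    using e a
  proof (elim disjE)
    assume "e = -1" "a = 1"
    then show ?thesis by (simp add: square map_replicate_const)
  next
    assume "e = -1" "a = -1"
    then show ?thesis by (simp add: square map_replicate_const)
  qed (simp_all add: o_def)
  finally have signs: "map (\<lambda>k. (-1) ^ k * (2 * b k)) [0..<m] \<in> \<dots>" .
  have "\<exists>K \<in> {conway_form as, conway_form as'}. conway_form bs \<in> {K, mirror K}"
    if "bs \<in> {as, map uminus as, as', map uminus as'}" for as as' bs
    using that by (auto simp: mirror_conway_form)
  from this[OF signs] show ?thesis .
qed simp

theorem theorem4p1:
  fixes nabla :: "diagram \<Rightarrow> int poly" and L :: diagram
    and c :: "nat \<Rightarrow> int" and m :: nat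
  assumes "conway_polynomial nabla"
    and "two_bridge L"
    and "m = degree (nabla L)"
    and "c = coeff (nabla L)"
  shows "nabla L = (\<Sum>k\<le>m div 2. monom (c (m - 2 * k)) (m - 2 * k)) \<and>
         (\<forall>k\<le>m div 2. \<bar>c (m - 2 * k)\<bar> \<le> int ((m - k) choose k) * \<bar>c m\<bar>) \<and>
         ((\<exists>k. 0 < k \<and> k < m div 2 \<and> \<bar>c (m - 2 * k)\<bar> = int ((m - k) choose k) * \<bar>c m\<bar>) \<longrightarrow>
            (\<forall>k\<le>m div 2. \<bar>c (m - 2 * k)\<bar> = int ((m - k) choose k) * \<bar>c m\<bar>) \<and>
            (\<exists>K \<in> {conway_form (map (\<lambda>k. (-1) ^ k * 2) [0..<m]), conway_form (replicate m 2)}.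
               isotopic L K \<or> isotopic L (mirror K)))"
proof -
  obtain bs where bs: "0 \<notin> set bs"
    and L: "isotopic L (conway_form (map (\<lambda>k. (-1) ^ k * (2 * bs ! k)) [0..<length bs]))"
    using assms(2) by (auto simp: two_bridge_def)
  define b where "b = (\<lambda>k. bs ! k)"
  have nz: "b j \<noteq> 0" if "j < length bs" for j
    using bs that by (metis b_def nth_mem)
  have nabla: "nabla L = continuant b (length bs)"
    using conway_isotopic[OF assms(1) L] conway_plat[OF assms(1)]
    by (simp add: conway_form_plat b_def)
  have m: "m = length bs"
    using degree_continuant[OF nz] assms(3) nabla by simp
  have c: "c (m - 2 * k) = continuant_coeff b m k" if "k \<le> m div 2" for k
    using coeff_continuant[OF that] assms(4) nabla m by simp
  have cm: "c m = (\<Prod>j<m. b j)"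
    using c[of 0] by (simp add: continuant_coeff_0)
  have L': "isotopic L (conway_form (map (\<lambda>k. (-1) ^ k * (2 * b k)) [0..<m]))"
    using L by (simp add: b_def m)
  have nz': "\<And>j. j < m \<Longrightarrow> b j \<noteq> 0" using nz m by simp
  show ?thesis
  proof (intro conjI impI allI)
    show "nabla L = (\<Sum>k\<le>m div 2. monom (c (m - 2 * k)) (m - 2 * k))"
      unfolding nabla m[symmetric] continuant_eq_sum using c by (intro sum.cong) auto
    show "\<bar>c (m - 2 * k)\<bar> \<le> int ((m - k) choose k) * \<bar>c m\<bar>" if "k \<le> m div 2" for k
      using continuant_coeff_bound[OF nz'] that by (simp add: c cm)
  next
    assume "\<exists>k. 0 < k \<and> k < m div 2 \<and> \<bar>c (m - 2 * k)\<bar> = int ((m - k) choose k) * \<bar>c m\<bar>"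
    then obtain k where "0 < k" "k < m div 2" "extremal b m k"
      by (auto simp: extremal_def c cm)
    then obtain e where e: "unit_geometric b m e"
      using extremal_imp_unit_geometric nz' by blast
    show "\<bar>c (m - 2 * k)\<bar> = int ((m - k) choose k) * \<bar>c m\<bar>" if "k \<le> m div 2" for k
      using extremal_unit_geometric[OF e] that by (simp add: extremal_def c cm)
    show "\<exists>K \<in> {conway_form (map (\<lambda>k. (-1) ^ k * 2) [0..<m]), conway_form (replicate m 2)}.
        isotopic L K \<or> isotopic L (mirror K)"
      using conway_form_unit_geometric[OF e] L' by auto
  qed
qed

end
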